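(* Let $m,n\equiv 2\pmod 4$ be positive integers, and let $A_{ee}=\{(x,y)\in\mathbb{Z}_m\times\mathbb{Z}_n:\ x,y\equiv 0\pmod 2\}$. Suppose there exists an $(\frac m2,\frac n2,3,1)$-OOSPC $\mathcal F$ whose leave is $L\subseteq\mathbb{Z}_{m/2}\times\mathbb{Z}_{n/2}$. Then there exists an $(m,n,3,2,1)$-OOSPC with $5|\mathcal F|$ codewords whose leave is $$L'=\Bigl(\bigcup_{(x,y)\in L\cup\{(0,0)\}}\bigl(D(x,y)\setminus A_{ee}\bigr)\Bigr)\cup\Bigl(\bigcup_{(x,y)\in L}\{(2x,2y)\}\Bigr).$$ Especially, if the given $(\frac m2,\frac n2,3,1)$-OOSPC is $(s,t)$-regular, then the resulting $(m,n,3,2,1)$-OOSPC is $(2s,2t)$-regular.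
   Context: For positive integers $m,n,k,\lambda_a,\lambda_c$, an $(m,n,k,\lambda_a,\lambda_c)$-OOSPC (optical orthogonal signature pattern code) is a set $\mathcal F$ of $k$-subsets (codewords) of $\mathbb{Z}_m\times\mathbb{Z}_n$ such that (1) $|X\cap (X+g)|\le\lambda_a$ for every $X\in\mathcal F$ and every $g\in\mathbb{Z}_m\times\mathbb{Z}_n\setminus\{(0,0)\}$; (2) $|X\cap(Y+g)|\le\lambda_c$ for all distinct $X,Y\in\mathcal F$ and every $g\in\mathbb{Z}_m\times\mathbb{Z}_n$. When $\lambda_a=\lambda_c=\lambda$ it is written $(m,n,k,\lambda)$-OOSPC. For a codeword $X$, $\mathrm{supp}(\Delta X)$ is the set of all differences $x-y$ with $x,y\in X$, $x\ne y$. The (difference) leave of an $(m,n,k,\lambda_a,1)$-OOSPC $\mathcal F$ is the set of all nonzero elements of $\mathbb{Z}_m\times\mathbb{Z}_n$ not in $\bigcup_{X\in\mathcal F}\mathrm{supp}(\Delta X)$. $\mathcal F$ is $(s,t)$-regular if its leave together with $(0,0)$ equals $S\times T$, where $S$ is the subgroup of order $s$ of $\mathbb{Z}_m$ and $T$ is the subgroup of order $t$ of $\mathbb{Z}_n$. For $(x,y)\in\mathbb{Z}_{m/2}\times\mathbb{Z}_{n/2}$, $D(x,y)=\{(x,y),(x,y+\frac n2),(x+\frac m2,y),(x+\frac m2,y+\frac n2)\}\subseteq\mathbb{Z}_m\times\mathbb{Z}_n$ (the set of preimages of $(x,y)$ under the reduction map $\mathbb{Z}_m\times\mathbb{Z}_n\to\mathbb{Z}_{m/2}\times\mathbb{Z}_{n/2}$),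 and $(2x,2y)$ denotes the well-defined element of $\mathbb{Z}_m\times\mathbb{Z}_n$ obtained by doubling integer representatives. *)

theory Defs
  imports "HOL-Algebra.Elementary_Groups"
begin

(* Elements of Z_m x Z_n are pairs of canonical integer representatives in {0..<m} x {0..<n}. *)
abbreviation Zmn :: "nat \<Rightarrow> nat \<Rightarrow> (int \<times> int) monoid" where
  "Zmn m n \<equiv> integer_mod_group m \<times>\<times> integer_mod_group n"

(* "X #> g" is the translate X + g. *)
definition oospc ::
  "nat \<Rightarrow> nat \<Rightarrow> nat \<Rightarrow> nat \<Rightarrow> nat \<Rightarrow> (int \<times> int) set set \<Rightarrow> bool" where
  "oospc m n k la lc F \<longleftrightarrow>
     m > 0 \<and> n > 0 \<and> k > 0 \<and> la > 0 \<and> lc > 0 \<and>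
     (\<forall>X\<in>F. X \<subseteq> carrier (Zmn m n) \<and> card X = k) \<and>
     (\<forall>X\<in>F. \<forall>g \<in> carrier (Zmn m n) - {(0, 0)}. card (X \<inter> (X #>\<^bsub>Zmn m n\<^esub> g)) \<le> la) \<and>
     (\<forall>X\<in>F. \<forall>Y\<in>F. X \<noteq> Y \<longrightarrow>
        (\<forall>g \<in> carrier (Zmn m n). card (X \<inter> (Y #>\<^bsub>Zmn m n\<^esub> g)) \<le> lc))"

definition supp_diff :: "nat \<Rightarrow> nat \<Rightarrow> (int \<times> int) set \<Rightarrow> (int \<times> int) set" where
  "supp_diff m n X = {x \<otimes>\<^bsub>Zmn m n\<^esub> inv\<^bsub>Zmn m n\<^esub> y | x y. x \<in> X \<and> y \<in> X \<and> x \<noteq> y}"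

definition leave :: "nat \<Rightarrow> nat \<Rightarrow> (int \<times> int) set set \<Rightarrow> (int \<times> int) set" where
  "leave m n F = {g \<in> carrier (Zmn m n). g \<noteq> (0, 0) \<and> g \<notin> (\<Union>X\<in>F. supp_diff m n X)}"

definition regular :: "nat \<Rightarrow> nat \<Rightarrow> nat \<Rightarrow> nat \<Rightarrow> (int \<times> int) set set \<Rightarrow> bool" where
  "regular m n s t F \<longleftrightarrow>
     (\<exists>S T. subgroup S (integer_mod_group m) \<and> card S = s \<and>
            subgroup T (integer_mod_group n) \<and> card T = t \<and>
            leave m n F \<union> {(0, 0)} = S \<times> T)"

definition A_ee :: "nat \<Rightarrow> nat \<Rightarrow> (int \<times> int) set" where
  "A_ee m n = {(x, y). (x, y) \<in> carrier (Zmn m n) \<and> even x \<and> even y}"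

(* D and dbl are applied to canonical representatives (x, y) in {0..<m/2} x {0..<n/2}
   with m, n even, so their values are canonical representatives in Z_m x Z_n without
   any further reduction. *)
definition D :: "nat \<Rightarrow> nat \<Rightarrow> int \<times> int \<Rightarrow> (int \<times> int) set" where
  "D m n = (\<lambda>(x, y). {(x, y), (x, y + int (n div 2)), (x + int (m div 2), y),
                      (x + int (m div 2), y + int (n div 2))})"

definition dbl :: "int \<times> int \<Rightarrow> int \<times> int" where
  "dbl = (\<lambda>(x, y). (2 * x, 2 * y))"

end

(* Put M = m/2 and N = n/2, both odd, so that by the Chinese remainder theorem every p in Z_M x Z_N
   has exactly one preimage in Z_m x Z_n for each pair of coordinate parities. Let l_i p (i = 1, 2, 3)
   be the preimages with parities (odd, even), (even, odd), (odd, odd), and l_0 p = 2p. Then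
   l_i p - l_j q = l_k (p - q) for {i, j, k} = {1, 2, 3}, and l_i p - l_i (-p) = l_0 p. A codeword
   {a, b, c} is replaced by the five codewords {l_1 a, l_2 b, l_3 c}, {l_2 a, l_3 b, l_1 c},
   {0, l_2 d, l_2 (-d)} for d = a - b, {0, l_3 d, l_3 (-d)} for d = b - c and
   {0, l_1 d, l_1 (-d)} for d = c - a. Their difference sets partition the set of all l_i d with
   0 <= i <= 3 and d a difference of {a, b, c}. *)
theory Submission
  imports Defs
begin

section \<open>Translates and differences in an abelian group\<close>

context comm_group
begin

text \<open>Links the two readings of a correlation: two points in the intersection with one
  translate, or one difference occurring twice.\<close>

lemma mult_inv_exchange:
  assumes "x \<in> carrier G" "y \<in> carrier G" "x' \<in> carrier G" "y' \<in> carrier G"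
    and "x \<otimes> inv y = x' \<otimes> inv y'"
  shows "x \<otimes> inv x' = y \<otimes> inv y'"
proof -
  have "x = x' \<otimes> inv y' \<otimes> y"
    using assms by (metis inv_closed inv_solve_right m_closed)
  then have "x = y \<otimes> inv y' \<otimes> x'"
    using assms(1-4) by (simp add: m_ac)
  then show ?thesis
    using assms(1-4) by (simp add: m_assoc)
qed

lemma mem_r_coset_iff:
  assumes "Y \<subseteq> carrier G" "g \<in> carrier G" "x \<in> carrier G"
  shows "x \<in> Y #> g \<longleftrightarrow> (\<exists>y\<in>Y. x \<otimes> inv y = g)"
proof
  assume "x \<in> Y #> g"
  then obtain y where "y \<in> Y" "x = y \<otimes> g" by (auto simp: r_coset_def)
  then show "\<exists>y\<in>Y. x \<otimes> inv y = g"
    using assms by (intro bexI[of _ y]) (auto simp: m_ac subset_iff inv_solve_left)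
next
  assume "\<exists>y\<in>Y. x \<otimes> inv y = g"
  then obtain y where "y \<in> Y" "x \<otimes> inv y = g" by blast
  then have "x = y \<otimes> g" using assms by (auto simp: subset_iff m_lcomm[of y x])
  with \<open>y \<in> Y\<close> show "x \<in> Y #> g" by (auto simp: r_coset_def)
qed

text \<open>Extracts uniqueness of differences from a correlation bound: a common difference puts
  both \<open>x\<close> and \<open>x'\<close> into the intersection of \<open>X\<close> with the
  translate of \<open>Y\<close> by x - y. The case \<open>Y = X\<close> is included.\<close>

lemma diff_eq_imp_eq:
  assumes "X \<subseteq> carrier G" "Y \<subseteq> carrier G" "finite X"
    and "x \<in> X" "x' \<in> X" "y \<in> Y" "y' \<in> Y"
    and "x \<otimes> inv x' = y \<otimes> inv y'"
    and "card (X \<inter> (Y #> (x \<otimes> inv y))) \<le> 1"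
  shows "x = x'"
proof -
  have c: "x \<in> carrier G" "x' \<in> carrier G" "y \<in> carrier G" "y' \<in> carrier G"
    using assms by auto
  have e: "x \<otimes> inv y = x' \<otimes> inv y'"
    using mult_inv_exchange[OF c(1,2,3,4)] assms(8) by simp
  have "x \<in> X \<inter> (Y #> (x \<otimes> inv y))" "x' \<in> X \<inter> (Y #> (x \<otimes> inv y))"
    using mem_r_coset_iff[OF assms(2), of "x \<otimes> inv y"] assms(4-7) c e by (metis IntI inv_closed m_closed)+
  moreover have "card (X \<inter> (Y #> (x \<otimes> inv y))) \<le> Suc 0" "finite (X \<inter> (Y #> (x \<otimes> inv y)))"
    using assms(3,9) by simp_all
  ultimately show ?thesis
    by (meson card_le_Suc0_iff_eq)
qed

text \<open>The converse direction, used to verify the new code: two points of the intersection come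
  from y, y' in \<open>Y\<close> with x - y = x' - y' = g, so \<open>X\<close> and \<open>Y\<close>
  share the difference x - x'.\<close>

lemma card_inter_translate_le_1:
  assumes "X \<subseteq> carrier G" "Y \<subseteq> carrier G" "finite X" "g \<in> carrier G"
    and "\<And>x x' y y'. \<lbrakk>x \<in> X; x' \<in> X; y \<in> Y; y' \<in> Y; x \<noteq> x'; y \<noteq> y'\<rbrakk>
           \<Longrightarrow> x \<otimes> inv x' \<noteq> y \<otimes> inv y'"
  shows "card (X \<inter> (Y #> g)) \<le> 1"
proof -
  have "x = x'" if h: "x \<in> X \<inter> (Y #> g)" "x' \<in> X \<inter> (Y #> g)" for x x'
  proof (rule ccontr)
    assume "x \<noteq> x'"
    have c: "x \<in> carrier G" "x' \<in> carrier G" using h assms(1) by auto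
    obtain y y' where y: "y \<in> Y" "y' \<in> Y" "x \<otimes> inv y = g" "x' \<otimes> inv y' = g"
      using h mem_r_coset_iff[OF assms(2,4) c(1)] mem_r_coset_iff[OF assms(2,4) c(2)] by blast
    have yc: "y \<in> carrier G" "y' \<in> carrier G" using y assms(2) by auto
    have "y \<noteq> y'" using y c yc \<open>x \<noteq> x'\<close> by (metis inv_closed right_cancel)
    moreover have "x \<otimes> inv x' = y \<otimes> inv y'"
      using mult_inv_exchange[OF c(1) yc(1) c(2) yc(2)] y by simp
    ultimately show False using assms(5)[of x x' y y'] h y(1,2) \<open>x \<noteq> x'\<close> by simp
  qed
  moreover have "finite (X \<inter> (Y #> g))" using assms(3) by simp
  ultimately show ?thesis
    by (simp only: One_nat_def card_le_Suc0_iff_eq) blast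
qed

text \<open>A triple invariant under a nonzero translation is cyclically permuted by it, so it is an
  arithmetic progression in every cyclic order.\<close>
lemma card_inter_self_translate_le_2:
  assumes "X = {x, y, z}" "X \<subseteq> carrier G" "x \<noteq> y" "y \<noteq> z" "x \<noteq> z"
    and "g \<in> carrier G" "g \<noteq> \<one>" and "x \<otimes> inv y \<noteq> y \<otimes> inv z"
  shows "card (X \<inter> (X #> g)) \<le> 2"
proof (rule ccontr)
  assume "\<not> ?thesis"
  moreover have "finite X" "card X = 3" using assms by auto
  ultimately have eq: "X \<inter> (X #> g) = X"
    by (intro card_seteq) auto
  have ex: "\<exists>v\<in>X. u \<otimes> inv v = g" if "u \<in> X" for u
    using that eq assms(2,6) mem_r_coset_iff[of X g u] by blast
  have self: "u \<otimes> inv u \<noteq> g" if "u \<in> X" for u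
    using that assms(2,7) by auto
  have swap: "u = w" if "u \<otimes> inv v = g" "w \<otimes> inv v = g" "u \<in> X" "v \<in> X" "w \<in> X" for u v w
    using that assms(2) by (metis inv_closed right_cancel subsetD)
  \<comment> \<open>Subtracting \<open>g\<close> permutes the three points without fixed points, so
    it is a 3-cycle; the two cases are its orientations.\<close>
  from ex[of x] ex[of y] ex[of z] self[of x] self[of y] self[of z]
  consider "x \<otimes> inv y = g" "y \<otimes> inv z = g" | "z \<otimes> inv y = g" "y \<otimes> inv x = g"
    using swap[of x y z] swap[of x z y] swap[of y x z] assms(1,3,4,5) by auto
  then show False
  proof cases
    case 1 then show False using assms(8) by simp
  next
    case 2
    then have "inv (z \<otimes> inv y) = inv (y \<otimes> inv x)" by simp
    then show False using assms by (simp add: inv_mult m_comm)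
  qed
qed

end

section \<open>Subtraction in Z_m x Z_n on canonical representatives\<close>

definition sub :: "nat \<Rightarrow> nat \<Rightarrow> int \<times> int \<Rightarrow> int \<times> int \<Rightarrow> int \<times> int" where
  "sub m n p q = ((fst p - fst q) mod int m, (snd p - snd q) mod int n)"

lemma comm_group_Zmn: "comm_group (Zmn m n)"
proof -
  interpret group "Zmn m n" by (simp add: DirProd_group)
  show ?thesis by (rule group_comm_groupI) (auto simp: add.commute)
qed

lemma carrier_Zmn: "m > 0 \<Longrightarrow> n > 0 \<Longrightarrow> carrier (Zmn m n) = {0..<int m} \<times> {0..<int n}"
  by (simp add: carrier_integer_mod_group)

lemma one_Zmn: "\<one>\<^bsub>Zmn m n\<^esub> = (0, 0)"
  by simp

lemma mult_inv_Zmn: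
  assumes "p \<in> carrier (Zmn m n)" "q \<in> carrier (Zmn m n)"
  shows "p \<otimes>\<^bsub>Zmn m n\<^esub> inv\<^bsub>Zmn m n\<^esub> q = sub m n p q"
  using assms by (cases p; cases q) (auto simp: sub_def inv_DirProd mod_simps)

lemma supp_diff_sub:
  assumes "X \<subseteq> carrier (Zmn m n)"
  shows "supp_diff m n X = {sub m n x y | x y. x \<in> X \<and> y \<in> X \<and> x \<noteq> y}"
proof -
  have "x \<otimes>\<^bsub>Zmn m n\<^esub> inv\<^bsub>Zmn m n\<^esub> y = sub m n x y" if "x \<in> X" "y \<in> X" for x y
    using that assms by (intro mult_inv_Zmn) (erule (1) subsetD)+
  then show ?thesis unfolding supp_diff_def by (intro Collect_cong ex_cong1) metis
qed

lemma image_pairs_triple: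
  assumes "a \<noteq> b" "b \<noteq> c" "c \<noteq> a"
  shows "{f x y | x y. x \<in> {a, b, c} \<and> y \<in> {a, b, c} \<and> x \<noteq> y} =
    {f a b, f b a, f b c, f c b, f c a, f a c}"
  using assms by auto

lemma supp_diff_triple:
  assumes "{a, b, c} \<subseteq> carrier (Zmn m n)" "a \<noteq> b" "b \<noteq> c" "c \<noteq> a"
  shows "supp_diff m n {a, b, c} =
    {sub m n a b, sub m n b a, sub m n b c, sub m n c b, sub m n c a, sub m n a c}"
  unfolding supp_diff_sub[OF assms(1)] using assms(2-4) by (rule image_pairs_triple)

lemma sub_in_carrier: "m > 0 \<Longrightarrow> n > 0 \<Longrightarrow> sub m n p q \<in> carrier (Zmn m n)"
  by (simp only: carrier_Zmn sub_def) auto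

section \<open>Chinese remainder lifts from Z_r to Z_2r with prescribed parity, for odd r\<close>

definition clift :: "int \<Rightarrow> bool \<Rightarrow> int \<Rightarrow> int" where
  "clift r p x = (if odd x = p then x else x + r)"

lemma clift_bounds: "0 \<le> x \<Longrightarrow> x < r \<Longrightarrow> 0 \<le> clift r p x \<and> clift r p x < 2 * r"
  by (simp add: clift_def)

lemma even_clift: "odd r \<Longrightarrow> even (clift r p x) \<longleftrightarrow> \<not> p"
  by (auto simp: clift_def)

lemma clift_mod: "clift r p x mod r = x mod r"
  by (simp add: clift_def)

text \<open>An element of Z_2r is determined by its parity and its residue modulo \<open>r\<close>;
  the identities for differences of lifts below come down to comparing these two data.\<close>

lemma clift_unique:
  assumes "odd r" "0 \<le> u" "u < 2 * r"
  shows "clift r (odd u) (u mod r) = u"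
proof (cases "u < r")
  case False
  then have "u mod r = u - r"
    using assms by (metis add_diff_cancel_right diff_ge_0_iff_ge linorder_not_less minus_mod_self2 mod_pos_pos_trivial mult_2 diff_less_eq)
  with assms show ?thesis by (simp add: clift_def)
qed (use assms in \<open>simp add: clift_def\<close>)

text \<open>Reduction modulo the even number \<open>2 * r\<close> preserves parity, so the parities
  combine by exclusive or, while modulo \<open>r\<close> the lifts disappear.\<close>

lemma clift_diff:
  assumes "odd r" "0 < r"
  shows "(clift r p x - clift r q y) mod (2 * r) = clift r (p \<noteq> q) ((x - y) mod r)"
proof -
  let ?v = "(clift r p x - clift r q y) mod (2 * r)"
  have "odd ?v \<longleftrightarrow> p \<noteq> q"
    using assms by (simp add: dvd_mod_iff even_clift)
  moreover have "?v mod r = (clift r p x - clift r q y) mod r"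
    by (simp add: mod_mod_cancel)
  moreover have "\<dots> = (x - y) mod r"
    by (metis clift_mod mod_diff_eq)
  moreover have "clift r (odd ?v) (?v mod r) = ?v"
    using assms by (intro clift_unique) auto
  ultimately show ?thesis by simp
qed

text \<open>Lifts of d and -d with equal parity differ by an even element congruent to 2d modulo
  \<open>r\<close>, and twice the representative of d is the only such element below
  \<open>2 * r\<close>. The negative is written with \<open>x\<close> and \<open>y\<close> swapped
  to match swapped arguments of \<open>sub\<close>.\<close>

lemma clift_diff_neg:
  assumes "odd r" "0 < r"
  shows "(clift r p ((x - y) mod r) - clift r p ((y - x) mod r)) mod (2 * r) = 2 * ((x - y) mod r)"
proof -
  let ?u = "2 * ((x - y) mod r)"
  have "((x - y) mod r - (y - x) mod r) mod r = ?u mod r"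
    by (simp only: mod_diff_eq mod_mult_right_eq) (simp add: algebra_simps)
  then show ?thesis
    using clift_unique[of r ?u] assms by (simp add: clift_diff)
qed

lemma clift_neg:
  assumes "odd r" "0 < r"
  shows "(- clift r p ((x - y) mod r)) mod (2 * r) = clift r p ((y - x) mod r)"
  \<comment> \<open>0 is its own even lift, so negation is subtraction from a lift.\<close>
  using clift_diff[OF assms, of False 0 p "(x - y) mod r"]
  by (simp add: clift_def[of r False 0] mod_simps)

section \<open>Four lifts from Z_M x Z_N to Z_2M x Z_2N and their differences\<close>

locale odd_moduli =
  fixes M N :: nat
  assumes odd_M: "odd M" and odd_N: "odd N"
begin

lemma pos: "M > 0" "N > 0"
  using odd_M odd_N by (auto intro: odd_pos)

definition A :: "(int \<times> int) set" where "A = {0..<int M} \<times> {0..<int N}"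
definition B :: "(int \<times> int) set" where "B = {0..<2 * int M} \<times> {0..<2 * int N}"
abbreviation sA where "sA \<equiv> sub M N"
abbreviation sB where "sB \<equiv> sub (2 * M) (2 * N)"

lemma carrier_A: "carrier (Zmn M N) = A"
  using carrier_Zmn pos by (simp only: A_def)

lemma carrier_B: "carrier (Zmn (2 * M) (2 * N)) = B"
  using carrier_Zmn[of "2 * M" "2 * N"] pos by (simp add: B_def)

lemma sA_in [simp]: "sA p q \<in> A"
  using sub_in_carrier[OF pos] by (simp only: carrier_A)

text \<open>For \<open>i = 1, 2, 3\<close> the parities of \<open>lam (i, p)\<close> are (odd, even), (even, odd), (odd, odd).
  Class 0 is the doubling map, not the even-even preimage of \<open>p\<close>.\<close>
definition lam :: "nat \<times> (int \<times> int) \<Rightarrow> int \<times> int" where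
  "lam = (\<lambda>(i, x, y). if i = 0 then (2 * x, 2 * y)
     else (clift (int M) (i \<noteq> 2) x, clift (int N) (i \<noteq> 1) y))"

lemma lam_0: "lam (0, p) = dbl p"
  by (cases p) (simp add: lam_def dbl_def)

lemma lam_in: "p \<in> A \<Longrightarrow> lam (i, p) \<in> B"
  unfolding A_def B_def lam_def by (auto simp: clift_bounds)

text \<open>The coordinate parities tell the four classes apart; within a class the point is
  recovered by reduction modulo \<open>M\<close> and \<open>N\<close>, or by halving in class
  0.\<close>

lemma inj_lam: "inj_on lam ({..3} \<times> A)"
proof (rule inj_onI, clarify)
  fix i j x y x' y'
  assume i: "i \<le> (3::nat)" and j: "j \<le> (3::nat)" and eq: "lam (i, x, y) = lam (j, x', y')"
    and p: "(x, y) \<in> A" "(x', y') \<in> A"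
  define u v where "u = fst (lam (i, x, y))" and "v = snd (lam (i, x, y))"
  have odds: "odd u \<longleftrightarrow> k \<noteq> 0 \<and> k \<noteq> 2" "odd v \<longleftrightarrow> k \<noteq> 0 \<and> k \<noteq> 1"
    if "lam (k, a, b) = (u, v)" for k a b
    using that odd_M odd_N by (auto simp: lam_def even_clift split: if_splits)
  have "i = j" using odds[of i x y] odds[of j x' y'] i j eq by (auto simp: u_def v_def)
  moreover have "x = x' \<and> y = y'"
  proof (cases "i = 0")
    case False
    then have "clift (int M) (i \<noteq> 2) x = clift (int M) (i \<noteq> 2) x'"
      "clift (int N) (i \<noteq> 1) y = clift (int N) (i \<noteq> 1) y'"
      using eq \<open>i = j\<close> by (simp_all add: lam_def)
    then have "x mod int M = x' mod int M" "y mod int N = y' mod int N"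
      by (metis clift_mod)+
    then show ?thesis using p by (simp add: A_def)
  qed (use eq \<open>i = j\<close> in \<open>simp add: lam_def\<close>)
  ultimately show "i = j \<and> (x, y) = (x', y')" by simp
qed

lemma lam_eq_iff:
  assumes "i \<le> 3" "j \<le> 3" "p \<in> A" "q \<in> A"
  shows "lam (i, p) = lam (j, q) \<longleftrightarrow> i = j \<and> p = q"
  using inj_on_eq_iff[OF inj_lam, of "(i, p)" "(j, q)"] assms by auto

text \<open>With \<open>inj_lam\<close>, this makes the labels (i, p) coordinates on
  \<open>B\<close>, so unions and complements of difference sets can be computed on labels.\<close>

lemma lam_surj: "lam ` ({..3} \<times> A) = B"
proof
  show "lam ` ({..3} \<times> A) \<subseteq> B" using lam_in by auto
  show "B \<subseteq> lam ` ({..3} \<times> A)"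
  proof clarify
    fix u v assume uv: "(u, v) \<in> B"
    show "(u, v) \<in> lam ` ({..3} \<times> A)"
    proof (cases "even u \<and> even v")
      case True
      then have "(u, v) = lam (0, u div 2, v div 2)" by (simp add: lam_def)
      moreover have "(u div 2, v div 2) \<in> A" using uv unfolding A_def B_def by auto
      ultimately show ?thesis by force
    next
      case False
      \<comment> \<open>The even-even case is settled, so the last branch is the parity pair (even,
        odd).\<close>
      define i :: nat where "i = (if odd u then if odd v then 3 else 1 else 2)"
      have "(u, v) = lam (i, u mod int M, v mod int N)"
        using False uv odd_M odd_N clift_unique[of "int M" u] clift_unique[of "int N" v]
        unfolding B_def by (auto simp: lam_def i_def)
      moreover have "(u mod int M, v mod int N) \<in> A" "i \<le> 3"
        using pos unfolding A_def i_def by auto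
      ultimately show ?thesis by force
    qed
  qed
qed

text \<open>The parity pairs of classes 1, 2, 3 are the nonzero elements of Z_2 x Z_2, where the
  difference of any two is the third.\<close>

lemma sB_lam_lam:
  assumes "(i, j, k) \<in> {(1, 2, 3), (2, 3, 1), (3, 1, 2), (2, 1, 3), (3, 2, 1), (1, 3, 2)}"
  shows "sB (lam (i, p)) (lam (j, q)) = lam (k, sA p q)"
  using assms odd_M odd_N pos by (cases p; cases q) (auto simp: lam_def sub_def clift_diff)

lemma sB_lam_neg:
  assumes "i \<noteq> 0"
  shows "sB (lam (i, sA p q)) (lam (i, sA q p)) = lam (0, sA p q)"
  using assms odd_M odd_N pos by (cases p; cases q) (auto simp: lam_def sub_def clift_diff_neg)

lemma sB_lam_zero:
  assumes "p \<in> A"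
  shows "sB (lam (i, p)) (0, 0) = lam (i, p)"
  using lam_in[OF assms, of i] unfolding B_def by (cases "lam (i, p)") (auto simp: sub_def)

lemma sB_zero_lam:
  assumes "i \<noteq> 0"
  shows "sB (0, 0) (lam (i, sA p q)) = lam (i, sA q p)"
  using assms odd_M odd_N pos by (cases p; cases q) (auto simp: lam_def sub_def clift_neg)

lemma zero_in_A [simp]: "(0, 0) \<in> A"
  using pos by (simp add: A_def)

lemma zero_eq_lam: "(0, 0) = lam (0, (0, 0))"
  by (simp add: lam_def)

lemma lam_eq_zero_iff:
  assumes "i \<le> 3" "p \<in> A"
  shows "lam (i, p) = (0, 0) \<longleftrightarrow> i = 0 \<and> p = (0, 0)"
  using assms lam_eq_iff[of i 0 p "(0, 0)"] by (simp add: zero_eq_lam[symmetric])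

lemma zero_in_B: "(0, 0) \<in> B"
  using lam_in[of "(0, 0)" 0] by (simp add: zero_eq_lam[symmetric])

section \<open>The five codewords obtained from one triple\<close>

lemma triple_autocorrelation:
  assumes "{x, y, z} \<subseteq> B" "x \<noteq> y" "y \<noteq> z" "z \<noteq> x" "sB x y \<noteq> sB y z" "g \<in> B - {(0, 0)}"
  shows "card ({x, y, z} \<inter> ({x, y, z} #>\<^bsub>Zmn (2 * M) (2 * N)\<^esub> g)) \<le> 2"
proof (rule comm_group.card_inter_self_translate_le_2[OF comm_group_Zmn refl])
  show "x \<otimes>\<^bsub>Zmn (2 * M) (2 * N)\<^esub> inv\<^bsub>Zmn (2 * M) (2 * N)\<^esub> y
      \<noteq> y \<otimes>\<^bsub>Zmn (2 * M) (2 * N)\<^esub> inv\<^bsub>Zmn (2 * M) (2 * N)\<^esub> z"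
    using assms by (simp only: mult_inv_Zmn carrier_B insert_subset not_False_eq_True)
qed (use assms in \<open>simp_all only: carrier_B one_Zmn Diff_iff insert_iff, auto\<close>)

text \<open>Collects what is demanded of a single new codeword. Recording its differences as a set
  \<open>U\<close> of labels turns cross-correlation into disjointness of label sets.\<close>

definition codeword_with_diffs :: "(int \<times> int) set \<Rightarrow> (nat \<times> int \<times> int) set \<Rightarrow> bool" where
  "codeword_with_diffs X U \<longleftrightarrow> X \<subseteq> B \<and> card X = 3 \<and>
     (\<forall>g \<in> B - {(0, 0)}. card (X \<inter> (X #>\<^bsub>Zmn (2 * M) (2 * N)\<^esub> g)) \<le> 2) \<and>
     supp_diff (2 * M) (2 * N) X = lam ` U"

lemma codeword_with_diffsI:
  assumes "{x, y, z} \<subseteq> B" "x \<noteq> y" "y \<noteq> z" "z \<noteq> x" "sB x y \<noteq> sB y z"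
    and "{sB x y, sB y x, sB y z, sB z y, sB z x, sB x z} = lam ` U"
  shows "codeword_with_diffs {x, y, z} U"
  unfolding codeword_with_diffs_def
  using assms triple_autocorrelation[OF assms(1-5)] supp_diff_triple[of x y z "2 * M" "2 * N"]
  by (simp only: carrier_B) auto

text \<open>The triple is ordered because the construction treats a - b, b - c and c - a
  differently; distinctness of the six differences is what autocorrelation at most 1
  provides.\<close>

definition good :: "(int \<times> int) \<times> (int \<times> int) \<times> (int \<times> int) \<Rightarrow> bool" where
  "good = (\<lambda>(a, b, c). {a, b, c} \<subseteq> A \<and> distinct [a, b, c] \<and>
     distinct [sA a b, sA b a, sA b c, sA c b, sA c a, sA a c])"

text \<open>Each pair of points yields differences in the class of the third point, so consecutive
  differences lie in distinct classes and no arithmetic progression arises.\<close>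

lemma transversal_codeword:
  assumes "(i, j, k) \<in> {(1, 2, 3), (2, 3, 1)}" "good (a, b, c)"
  shows "codeword_with_diffs {lam (i, a), lam (j, b), lam (k, c)}
    {(k, sA a b), (k, sA b a), (i, sA b c), (i, sA c b), (j, sA c a), (j, sA a c)}"
proof -
  have "sB (lam (i, a)) (lam (j, b)) = lam (k, sA a b)" "sB (lam (j, b)) (lam (i, a)) = lam (k, sA b a)"
    "sB (lam (j, b)) (lam (k, c)) = lam (i, sA b c)" "sB (lam (k, c)) (lam (j, b)) = lam (i, sA c b)"
    "sB (lam (k, c)) (lam (i, a)) = lam (j, sA c a)" "sB (lam (i, a)) (lam (k, c)) = lam (j, sA a c)"
    by (rule sB_lam_lam; use assms(1) in auto)+
  moreover have "i \<le> 3" "j \<le> 3" "k \<le> 3" "i \<noteq> j" "j \<noteq> k" "k \<noteq> i"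
    using assms(1) by auto
  moreover have "a \<in> A" "b \<in> A" "c \<in> A"
    using assms(2) by (simp_all add: good_def)
  ultimately show ?thesis
    by (intro codeword_with_diffsI) (simp_all add: lam_in lam_eq_iff)
qed

text \<open>With d = a - b, the differences in class \<open>i\<close> occur twice each, once on
  either side of (0, 0); hence only autocorrelation at most 2 is reached. The two outer points
  contribute 2d and -2d, which form class 0.\<close>

lemma symmetric_codeword:
  assumes "i \<in> {1, 2, 3}" "sA a b \<noteq> sA b a"
  shows "codeword_with_diffs {(0, 0), lam (i, sA a b), lam (i, sA b a)}
    {(i, sA a b), (i, sA b a), (0, sA a b), (0, sA b a)}"
proof -
  have i: "i \<le> 3" "i \<noteq> 0" using assms(1) by auto
  have "lam (i, sA p q) \<noteq> (0, 0)" for p q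
    using i by (simp add: lam_eq_zero_iff)
  then have "(0, 0) \<noteq> lam (i, sA a b)" "lam (i, sA b a) \<noteq> (0, 0)"
    by metis+
  moreover have "sB (0, 0) (lam (i, sA a b)) = lam (i, sA b a)" "sB (0, 0) (lam (i, sA b a)) = lam (i, sA a b)"
    "sB (lam (i, sA a b)) (0, 0) = lam (i, sA a b)" "sB (lam (i, sA b a)) (0, 0) = lam (i, sA b a)"
    "sB (lam (i, sA a b)) (lam (i, sA b a)) = lam (0, sA a b)"
    "sB (lam (i, sA b a)) (lam (i, sA a b)) = lam (0, sA b a)"
    using i by (simp_all add: sB_zero_lam sB_lam_zero sB_lam_neg)
  ultimately show ?thesis
    using i assms(2)
    by (intro codeword_with_diffsI) (simp_all add: lam_in zero_in_B lam_eq_iff insert_commute)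
qed

text \<open>Up to sign, the differences of \<open>{a, b, c}\<close> are \<open>a - b\<close>, \<open>b - c\<close>, \<open>c - a\<close>. Each of them has to
  be lifted to the three odd classes 1, 2, 3 and, doubled, to class 0; \<open>diff_labels i\<close> lists
  the lifts produced by \<open>codeword i\<close>.\<close>
definition codeword ::
  "nat \<Rightarrow> (int \<times> int) \<times> (int \<times> int) \<times> (int \<times> int) \<Rightarrow> (int \<times> int) set" where
  "codeword i = (\<lambda>(a, b, c).
    [{lam (1, a), lam (2, b), lam (3, c)},
     {lam (2, a), lam (3, b), lam (1, c)},
     {(0, 0), lam (2, sA a b), lam (2, sA b a)},
     {(0, 0), lam (3, sA b c), lam (3, sA c b)},
     {(0, 0), lam (1, sA c a), lam (1, sA a c)}] ! i)"

definition pm :: "int \<times> int \<Rightarrow> int \<times> int \<Rightarrow> (int \<times> int) set" where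
  "pm a b = {sA a b, sA b a}"

definition diff_labels ::
  "nat \<Rightarrow> (int \<times> int) \<times> (int \<times> int) \<times> (int \<times> int) \<Rightarrow> (nat \<times> int \<times> int) set" where
  "diff_labels i = (\<lambda>(a, b, c).
    [{2} \<times> pm c a \<union> {1} \<times> pm b c \<union> {3} \<times> pm a b,
     {3} \<times> pm c a \<union> {2} \<times> pm b c \<union> {1} \<times> pm a b,
     {2, 0} \<times> pm a b,
     {3, 0} \<times> pm b c,
     {1, 0} \<times> pm c a] ! i)"

definition triple_diffs :: "(int \<times> int) \<times> (int \<times> int) \<times> (int \<times> int) \<Rightarrow> (int \<times> int) set" where
  "triple_diffs = (\<lambda>(a, b, c). pm a b \<union> pm b c \<union> pm c a)"

lemma times_pm: "{i} \<times> pm a b = {(i, sA a b), (i, sA b a)}"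
    "{i, j} \<times> pm a b = {(i, sA a b), (i, sA b a), (j, sA a b), (j, sA b a)}"
  unfolding pm_def by blast+

lemma less_5_iff: "i < 5 \<longleftrightarrow> i \<in> {0, 1, 2, 3, 4 :: nat}"
  by auto

lemma codeword_diffs:
  assumes "good t" "i < 5"
  shows "codeword_with_diffs (codeword i t) (diff_labels i t)"
proof -
  obtain a b c where t: "t = (a, b, c)" by (cases t)
  have "sA a b \<noteq> sA b a" "sA b c \<noteq> sA c b" "sA c a \<noteq> sA a c"
    using assms(1) by (auto simp: t good_def)
  then have "codeword_with_diffs (codeword 0 t) (diff_labels 0 t)"
    "codeword_with_diffs (codeword 1 t) (diff_labels 1 t)"
    "codeword_with_diffs (codeword 2 t) (diff_labels 2 t)"
    "codeword_with_diffs (codeword 3 t) (diff_labels 3 t)"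
    "codeword_with_diffs (codeword 4 t) (diff_labels 4 t)"
    using assms(1) transversal_codeword[of 1 2 3 a b c] transversal_codeword[of 2 3 1 a b c]
      symmetric_codeword[of 2 a b] symmetric_codeword[of 3 b c] symmetric_codeword[of 1 c a]
    by (simp_all add: t codeword_def diff_labels_def times_pm)
  then show ?thesis
    using assms(2) unfolding less_5_iff by auto
qed

text \<open>The first two codewords give a - b the classes 3 and 1, b - c the classes 1 and 2, and c
  - a the classes 2 and 3; for each of these the matching symmetric codeword adds the missing odd
  class and class 0.\<close>

lemma UN_diff_labels: "(\<Union>i<5. diff_labels i t) = {..3} \<times> triple_diffs t"
proof -
  obtain a b c where t: "t = (a, b, c)" by (cases t)
  have 5: "{..<5} = {0, 1, 2, 3, 4 :: nat}" and 3: "{..3} = {0, 1, 2, 3 :: nat}" by auto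
  show ?thesis
    unfolding 5 3 t diff_labels_def triple_diffs_def by auto
qed

lemma diff_labels_subset: "i < 5 \<Longrightarrow> diff_labels i t \<subseteq> {..3} \<times> triple_diffs t"
  using UN_upper[of i "{..<5}" "\<lambda>i. diff_labels i t"] by (simp add: UN_diff_labels)

text \<open>Serves the count: codewords with disjoint nonempty difference sets are distinct.\<close>

lemma diff_labels_nonempty: "i < 5 \<Longrightarrow> diff_labels i t \<noteq> {}"
  by (cases t) (auto simp: less_5_iff diff_labels_def pm_def)

text \<open>Labels over different \<open>pm\<close> sets differ in the point, labels over the same
  \<open>pm\<close> set in the class.\<close>

lemma diff_labels_disjoint:
  assumes "good t" "i < 5" "j < 5" "i \<noteq> j"
  shows "diff_labels i t \<inter> diff_labels j t = {}"
proof -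
  obtain a b c where t: "t = (a, b, c)" by (cases t)
  have "pm a b \<inter> pm b c = {}" "pm b c \<inter> pm c a = {}" "pm c a \<inter> pm a b = {}"
    using assms(1) by (auto simp: t good_def pm_def)
  then have "\<forall>i\<in>{0, 1, 2, 3, 4}. \<forall>j\<in>{0, 1, 2, 3, 4}. i \<noteq> j \<longrightarrow> diff_labels i t \<inter> diff_labels j t = {}"
    unfolding t diff_labels_def by (simp add: Int_Un_distrib Int_Un_distrib2 Times_Int_Times Int_commute)
  then show ?thesis
    using assms(2-4) unfolding less_5_iff by auto
qed

lemma triple_diffs_subset: "triple_diffs t \<subseteq> A"
  by (cases t) (auto simp: triple_diffs_def pm_def)

section \<open>Differences in the given code\<close>

lemma mult_inv_A: "p \<in> A \<Longrightarrow> q \<in> A \<Longrightarrow> p \<otimes>\<^bsub>Zmn M N\<^esub> inv\<^bsub>Zmn M N\<^esub> q = sA p q"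
  by (rule mult_inv_Zmn; simp only: carrier_A)

lemma mult_inv_B: "p \<in> B \<Longrightarrow> q \<in> B \<Longrightarrow>
    p \<otimes>\<^bsub>Zmn (2 * M) (2 * N)\<^esub> inv\<^bsub>Zmn (2 * M) (2 * N)\<^esub> q = sB p q"
  by (rule mult_inv_Zmn; simp only: carrier_B)

lemma sA_right_cancel:
  assumes "p \<in> A" "q \<in> A" "sA r p = sA r q"
  shows "p = q"
proof -
  have "x = y" if "0 \<le> x" "x < k" "0 \<le> y" "y < k" "(z - x) mod k = (z - y) mod k" for x y z k :: int
  proof -
    have "(z - (z - u) mod k) mod k = u mod k" for u by (simp add: mod_diff_right_eq)
    then have "x mod k = y mod k" using that(5) by metis
    then show ?thesis using that by simp
  qed
  then show ?thesis
    using assms by (cases p; cases q) (auto simp: A_def sub_def)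
qed

lemma sA_eq_zero_iff:
  assumes "p \<in> A" "q \<in> A"
  shows "sA p q = (0, 0) \<longleftrightarrow> p = q"
  using assms sA_right_cancel[of p q p] by (auto simp: sub_def)

lemma oospc_codeword:
  assumes "oospc M N 3 1 1 F" "X \<in> F"
  shows "X \<subseteq> A" "card X = 3" "finite X"
  using assms unfolding oospc_def by (auto simp only: carrier_A intro: card_ge_0_finite)

text \<open>If x and y differed, the translate of \<open>X\<close> by the nonzero element x - y
  would meet \<open>X\<close> in both \<open>x\<close> and \<open>x'\<close>.\<close>

lemma oospc_auto_diffs:
  assumes F: "oospc M N 3 1 1 F" "X \<in> F"
    and x: "x \<in> X" "x' \<in> X" "y \<in> X" "y' \<in> X" "x \<noteq> x'" and eq: "sA x x' = sA y y'"
  shows "x = y \<and> x' = y'"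
proof -
  note X = oospc_codeword[OF F]
  have A: "x \<in> A" "x' \<in> A" "y \<in> A" "y' \<in> A" using x X by auto
  have "x = y"
  proof (rule ccontr)
    assume "x \<noteq> y"
    then have "sA x y \<in> A - {(0, 0)}" using A by (simp add: sA_eq_zero_iff)
    then have "card (X \<inter> (X #>\<^bsub>Zmn M N\<^esub> sA x y)) \<le> 1"
      using F unfolding oospc_def carrier_A by blast
    then have "x = x'"
      using comm_group.diff_eq_imp_eq[OF comm_group_Zmn, of X M N X x x' y y'] X x eq A
      by (simp only: carrier_A mult_inv_A simp_thms True_implies_equals)
    with x show False by simp
  qed
  with eq A show ?thesis using sA_right_cancel by blast
qed

text \<open>Same argument between two codewords; here x - y may be zero, since the cross-correlation
  bound covers every translation.\<close>

lemma oospc_cross_diffs: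
  assumes F: "oospc M N 3 1 1 F" "X \<in> F" "Y \<in> F" "X \<noteq> Y"
    and x: "x \<in> X" "x' \<in> X" "y \<in> Y" "y' \<in> Y" "x \<noteq> x'"
  shows "sA x x' \<noteq> sA y y'"
proof
  assume eq: "sA x x' = sA y y'"
  note X = oospc_codeword[OF F(1,2)] and Y = oospc_codeword[OF F(1,3)]
  have A: "x \<in> A" "x' \<in> A" "y \<in> A" "y' \<in> A" using x X Y by auto
  have "card (X \<inter> (Y #>\<^bsub>Zmn M N\<^esub> sA x y)) \<le> 1"
    using F sA_in[of x y] unfolding oospc_def carrier_A by blast
  then have "x = x'"
    using comm_group.diff_eq_imp_eq[OF comm_group_Zmn, of X M N Y x x' y y'] X Y x eq A
    by (simp only: carrier_A mult_inv_A simp_thms True_implies_equals)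
  with x show False by simp
qed

text \<open>Any enumeration of \<open>X\<close> serves, as its six ordered differences are pairwise
  distinct.\<close>

lemma oospc_obtain_triple:
  assumes F: "oospc M N 3 1 1 F" "X \<in> F"
  shows "\<exists>t. good t \<and> triple_diffs t = supp_diff M N X"
proof -
  obtain a b c where X: "X = {a, b, c}" "a \<noteq> b" "b \<noteq> c" "c \<noteq> a"
    using oospc_codeword(2)[OF F] by (auto simp: card_3_iff)
  have A: "{a, b, c} \<subseteq> A" using oospc_codeword(1)[OF F] X by simp
  have ne: "sA x x' \<noteq> sA y y'"
    if "x \<in> X" "x' \<in> X" "y \<in> X" "y' \<in> X" "x \<noteq> x'" "x \<noteq> y \<or> x' \<noteq> y'" for x x' y y'
    using oospc_auto_diffs[OF F that(1-5)] that(6) by blast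
  have "distinct [sA a b, sA b a, sA b c, sA c b, sA c a, sA a c]"
    using X(2-4) by (simp add: ne X(1))
  then have "good (a, b, c)" using A X(2-4) by (simp add: good_def)
  moreover have "triple_diffs (a, b, c) = supp_diff M N X"
    using supp_diff_triple[of a b c M N] A X by (simp only: carrier_A) (auto simp: triple_diffs_def pm_def)
  ultimately show ?thesis by blast
qed

lemma mem_supp_diff:
  assumes "X \<subseteq> A"
  shows "d \<in> supp_diff M N X \<longleftrightarrow> (\<exists>x\<in>X. \<exists>y\<in>X. x \<noteq> y \<and> d = sA x y)"
  unfolding supp_diff_sub[OF assms[folded carrier_A]] by blast

lemma supp_diff_disjoint:
  assumes "oospc M N 3 1 1 F" "X \<in> F" "Y \<in> F" "X \<noteq> Y"
  shows "supp_diff M N X \<inter> supp_diff M N Y = {}"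
proof -
  have "X \<subseteq> A" "Y \<subseteq> A" using oospc_codeword(1) assms by blast+
  then show ?thesis
    using oospc_cross_diffs[OF assms] by (simp only: disjoint_iff mem_supp_diff) metis
qed

lemma supp_diff_subset:
  assumes "X \<subseteq> A"
  shows "supp_diff M N X \<subseteq> A - {(0, 0)}"
proof
  fix d assume "d \<in> supp_diff M N X"
  then obtain x y where "x \<in> X" "y \<in> X" "x \<noteq> y" "d = sA x y"
    using mem_supp_diff[OF assms] by blast
  then show "d \<in> A - {(0, 0)}"
    using sA_eq_zero_iff[of x y] assms by (simp add: subset_iff del: split_paired_All)
qed

text \<open>Adding the odd numbers \<open>M\<close> or \<open>N\<close> flips a parity, so the four
  preimages of \<open>p\<close> realize all four parity pairs; without the even-even one, the lifts
  of classes 1, 2, 3 remain.\<close>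

lemma D_diff_A_ee:
  assumes "p \<in> A"
  shows "D (2 * M) (2 * N) p - A_ee (2 * M) (2 * N) = lam ` ({1, 2, 3} \<times> {p})"
proof -
  obtain x y where p: "p = (x, y)" by (cases p)
  have "q \<in> B" if "q \<in> D (2 * M) (2 * N) p" for q
    using that assms by (auto simp: p D_def A_def B_def)
  then have "D (2 * M) (2 * N) p - A_ee (2 * M) (2 * N) =
      {q \<in> D (2 * M) (2 * N) p. \<not> (even (fst q) \<and> even (snd q))}"
    unfolding A_ee_def carrier_B by auto
  also have "\<dots> = lam ` ({1, 2, 3} \<times> {p})"
    using odd_M odd_N pos
    by (cases "even x"; cases "even y") (auto simp: p D_def lam_def clift_def)
  finally show ?thesis .
qed

section \<open>Assembly of the doubled code\<close>

lemma mem_supp_diff_B: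
  assumes "X \<subseteq> B"
  shows "d \<in> supp_diff (2 * M) (2 * N) X \<longleftrightarrow> (\<exists>x\<in>X. \<exists>y\<in>X. x \<noteq> y \<and> d = sB x y)"
  unfolding supp_diff_sub[OF assms[folded carrier_B]] by blast

lemma cross_correlation:
  assumes "X \<subseteq> B" "Y \<subseteq> B" "finite X" "g \<in> B"
    and "supp_diff (2 * M) (2 * N) X \<inter> supp_diff (2 * M) (2 * N) Y = {}"
  shows "card (X \<inter> (Y #>\<^bsub>Zmn (2 * M) (2 * N)\<^esub> g)) \<le> 1"
proof (rule comm_group.card_inter_translate_le_1[OF comm_group_Zmn])
  fix x x' y y' assume xy: "x \<in> X" "x' \<in> X" "y \<in> Y" "y' \<in> Y" "x \<noteq> x'" "y \<noteq> y'"
  then have "sB x x' \<noteq> sB y y'"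
    using assms(5) mem_supp_diff_B[OF assms(1)] mem_supp_diff_B[OF assms(2)] by (metis disjoint_iff)
  then show "x \<otimes>\<^bsub>Zmn (2 * M) (2 * N)\<^esub> inv\<^bsub>Zmn (2 * M) (2 * N)\<^esub> x'
      \<noteq> y \<otimes>\<^bsub>Zmn (2 * M) (2 * N)\<^esub> inv\<^bsub>Zmn (2 * M) (2 * N)\<^esub> y'"
    using assms(1,2) xy by (simp add: mult_inv_B subset_iff del: split_paired_All)
qed (use assms in \<open>simp_all only: carrier_B\<close>)

lemma lam_image_subset: "U \<subseteq> {..3} \<times> A \<Longrightarrow> V \<subseteq> {..3} \<times> A \<Longrightarrow> U \<inter> V = {} \<Longrightarrow> lam ` U \<inter> lam ` V = {}"
  by (metis inj_on_image_Int[OF inj_lam] image_empty)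

lemma doubled_oospc:
  assumes F: "oospc M N 3 1 1 F"
  obtains G where "oospc (2 * M) (2 * N) 3 2 1 G" "card G = 5 * card F"
    "(\<Union>W\<in>G. supp_diff (2 * M) (2 * N) W) = lam ` ({..3} \<times> (\<Union>X\<in>F. supp_diff M N X))"
proof -
  obtain f where f: "\<And>X. X \<in> F \<Longrightarrow> good (f X)" "\<And>X. X \<in> F \<Longrightarrow> triple_diffs (f X) = supp_diff M N X"
    using oospc_obtain_triple[OF F] by metis
  define w where "w = (\<lambda>(i, X). codeword i (f X))"
  define l where "l = (\<lambda>(i, X). diff_labels i (f X))"
  \<comment> \<open>New codewords are indexed by their type and the codeword of \<open>F\<close>
    they come from.\<close>
  define J where "J = {..<5 :: nat} \<times> F"
  have l_sub: "l j \<subseteq> {..3} \<times> supp_diff M N (snd j)" if "j \<in> J" for j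
    using that diff_labels_subset[of "fst j" "f (snd j)"] f(2)[of "snd j"]
    by (simp add: J_def l_def split_beta mem_Times_iff)
  have l_A: "l j \<subseteq> {..3} \<times> A" if "j \<in> J" for j
  proof -
    have "supp_diff M N (snd j) \<subseteq> A"
      using that triple_diffs_subset[of "f (snd j)"] f(2)[of "snd j"] by (auto simp: J_def)
    then show ?thesis using l_sub[OF that] by blast
  qed
  have l_ne: "l j \<noteq> {}" if "j \<in> J" for j
    using that diff_labels_nonempty[of "fst j" "f (snd j)"] by (auto simp: J_def l_def)
  \<comment> \<open>Labels from one codeword of \<open>F\<close> are separated by type; those from
    different codewords lie over disjoint difference sets.\<close>
  have l_disj: "l j \<inter> l j' = {}" if "j \<in> J" "j' \<in> J" "j \<noteq> j'" for j j'
  proof (cases "snd j = snd j'")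
    case True
    then show ?thesis using that diff_labels_disjoint[of "f (snd j)" "fst j" "fst j'"] f(1)[of "snd j"]
      by (simp add: J_def l_def split_beta mem_Times_iff prod_eq_iff)
  next
    case False
    then have "supp_diff M N (snd j) \<inter> supp_diff M N (snd j') = {}"
      using that supp_diff_disjoint[OF F, of "snd j" "snd j'"] by (simp add: J_def mem_Times_iff)
    then show ?thesis using l_sub[OF that(1)] l_sub[OF that(2)] by blast
  qed
  have w: "codeword_with_diffs (w j) (l j)" if "j \<in> J" for j
    using that codeword_diffs[of "f (snd j)" "fst j"] f(1)[of "snd j"]
    by (auto simp: J_def w_def l_def)
  have w_disj: "supp_diff (2 * M) (2 * N) (w j) \<inter> supp_diff (2 * M) (2 * N) (w j') = {}"
    if "j \<in> J" "j' \<in> J" "j \<noteq> j'" for j j'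
    using w[OF that(1)] w[OF that(2)] lam_image_subset[OF l_A[OF that(1)] l_A[OF that(2)] l_disj[OF that]]
    by (simp add: codeword_with_diffs_def)
  \<comment> \<open>Equal codewords at distinct indices would have a difference set disjoint from
    itself, hence empty.\<close>
  have inj: "inj_on w J"
  proof (rule inj_onI, rule ccontr)
    fix j j' assume j: "j \<in> J" "j' \<in> J" "w j = w j'" "j \<noteq> j'"
    then have "supp_diff (2 * M) (2 * N) (w j) = {}" using w_disj[of j j'] by simp
    then show False using w[OF j(1)] l_ne[OF j(1)] by (simp add: codeword_with_diffs_def)
  qed
  show ?thesis
  proof
    show "card (w ` J) = 5 * card F"
      using card_image[OF inj] by (simp add: J_def card_cartesian_product)
    have "(\<Union>W\<in>w ` J. supp_diff (2 * M) (2 * N) W) = (\<Union>j\<in>J. lam ` l j)"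
      using w by (simp add: codeword_with_diffs_def)
    also have "\<dots> = (\<Union>X\<in>F. lam ` (\<Union>i<5. diff_labels i (f X)))"
      by (auto simp: J_def l_def)
    also have "\<dots> = lam ` ({..3} \<times> (\<Union>X\<in>F. supp_diff M N X))"
      using f(2) by (simp add: UN_diff_labels) blast
    finally show "(\<Union>W\<in>w ` J. supp_diff (2 * M) (2 * N) W) = lam ` ({..3} \<times> (\<Union>X\<in>F. supp_diff M N X))" .
    show "oospc (2 * M) (2 * N) 3 2 1 (w ` J)"
      unfolding oospc_def carrier_B
    proof (intro conjI ballI impI)
      fix W g assume "W \<in> w ` J" "g \<in> B - {(0, 0)}"
      then show "card (W \<inter> (W #>\<^bsub>Zmn (2 * M) (2 * N)\<^esub> g)) \<le> 2"
        using w unfolding codeword_with_diffs_def by blast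
    next
      fix W W' g assume W: "W \<in> w ` J" "W' \<in> w ` J" "W \<noteq> W'" and g: "g \<in> B"
      then obtain j j' where j: "j \<in> J" "j' \<in> J" "j \<noteq> j'" and eq: "W = w j" "W' = w j'" by blast
      have "W \<subseteq> B" "W' \<subseteq> B"
        using w[OF j(1)] w[OF j(2)] by (simp_all add: eq codeword_with_diffs_def)
      moreover from this have "finite W"
        by (simp add: B_def finite_subset)
      ultimately show "card (W \<inter> (W' #>\<^bsub>Zmn (2 * M) (2 * N)\<^esub> g)) \<le> 1"
        using cross_correlation[of W W' g] g w_disj[OF j] by (simp add: eq)
    next
      fix W assume "W \<in> w ` J"
      then show "W \<subseteq> B" "card W = 3" using w unfolding codeword_with_diffs_def by blast+
    qed (use pos in simp_all)
  qed
qed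

section \<open>The leave of the doubled code\<close>

lemma leave_eq:
  assumes "(\<Union>W\<in>G. supp_diff (2 * M) (2 * N) W) = lam ` ({..3} \<times> (\<Union>X\<in>F. supp_diff M N X))"
    and F: "oospc M N 3 1 1 F"
  shows "leave (2 * M) (2 * N) G =
    lam ` ({1, 2, 3} \<times> (leave M N F \<union> {(0, 0)}) \<union> {0} \<times> leave M N F)"
proof -
  define U where "U = (\<Union>X\<in>F. supp_diff M N X)"
  have U: "U \<subseteq> A - {(0, 0)}"
    unfolding U_def using oospc_codeword(1)[OF F] supp_diff_subset by blast
  have L: "leave M N F = A - {(0, 0)} - U"
    unfolding leave_def carrier_A U_def by auto
  have "leave (2 * M) (2 * N) G = lam ` ({..3} \<times> A) - lam ` {(0, (0, 0))} - lam ` ({..3} \<times> U)"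
    unfolding leave_def carrier_B assms lam_surj U_def[symmetric] by (auto simp: lam_0 dbl_def)
  also have "\<dots> = lam ` ({..3} \<times> A - {(0, (0, 0))} - {..3} \<times> U)"
  proof -
    have "lam ` ({..3} \<times> A - {(0, (0, 0))}) = lam ` ({..3} \<times> A) - lam ` {(0, (0, 0))}"
      by (rule inj_on_image_set_diff[OF inj_lam]) auto
    moreover have "lam ` ({..3} \<times> A - {(0, (0, 0))} - {..3} \<times> U) =
        lam ` ({..3} \<times> A - {(0, (0, 0))}) - lam ` ({..3} \<times> U)"
      by (rule inj_on_image_set_diff[OF inj_lam]) (use U in blast)+
    ultimately show ?thesis by simp
  qed
  \<comment> \<open>Only class 0 loses its label over (0, 0), the zero of \<open>B\<close>. In
    classes 1, 2, 3 that label survives, since (0, 0) is no difference; this is why (0, 0) is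
    adjoined to the leave there.\<close>
  also have "{..3 :: nat} \<times> A - {(0, (0, 0))} - {..3} \<times> U =
      {1, 2, 3} \<times> (leave M N F \<union> {(0, 0)}) \<union> {0} \<times> leave M N F"
  proof -
    define K where "K = {1, 2, 3 :: nat}"
    have "{..3} = insert 0 K" "0 \<notin> K" by (auto simp: K_def)
    moreover have "(0, 0) \<notin> U" "(0, 0) \<in> A" using U by auto
    ultimately show ?thesis unfolding L K_def[symmetric] by auto
  qed
  finally show ?thesis .
qed

lemma leave_subset: "leave M N F \<subseteq> A"
  unfolding leave_def carrier_A by blast

lemma lam_leave_eq:
  assumes "L \<subseteq> A"
  shows "lam ` ({1, 2, 3} \<times> (L \<union> {(0, 0)}) \<union> {0} \<times> L) =
    (\<Union>p \<in> L \<union> {(0, 0)}. D (2 * M) (2 * N) p - A_ee (2 * M) (2 * N)) \<union> (\<Union>p \<in> L. {dbl p})"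
proof -
  have "(\<Union>p \<in> L \<union> {(0, 0)}. D (2 * M) (2 * N) p - A_ee (2 * M) (2 * N)) =
      (\<Union>p \<in> L \<union> {(0, 0)}. lam ` ({1, 2, 3} \<times> {p}))"
    using assms zero_in_A by (intro SUP_cong refl D_diff_A_ee) blast
  also have "\<dots> = lam ` ({1, 2, 3} \<times> (L \<union> {(0, 0)}))" by blast
  finally have 1: "(\<Union>p \<in> L \<union> {(0, 0)}. D (2 * M) (2 * N) p - A_ee (2 * M) (2 * N)) =
    lam ` ({1, 2, 3} \<times> (L \<union> {(0, 0)}))" .
  have "(\<Union>p \<in> L. {dbl p}) = lam ` ({0} \<times> L)"
    unfolding lam_0[symmetric] by blast
  with 1 show ?thesis by (simp only: image_Un)
qed

end

section \<open>Regularity: subgroups of Z_r and their preimages in Z_2r\<close>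

lemma subgroup_clift:
  assumes "odd r" and S: "subgroup S (integer_mod_group r)"
  defines "S' \<equiv> clift (int r) True ` S \<union> clift (int r) False ` S"
  shows "subgroup S' (integer_mod_group (2 * r))" "card S' = 2 * card S"
    "clift (int r) False ` S = (\<lambda>x. 2 * x) ` S"
proof -
  have r: "odd (int r)" "0 < int r" using assms(1) by (auto intro: odd_pos)
  have Sr: "S \<subseteq> {0..<int r}"
    using subgroup.subset[OF S] r by (simp add: carrier_integer_mod_group)
  then have fin: "finite S" by (rule finite_subset) simp
  have closed: "(x + y) mod int r \<in> S" if "x \<in> S" "y \<in> S" for x y
    using subgroup.m_closed[OF S that] by simp
  have inv_closed: "(- x) mod int r \<in> S" if "x \<in> S" for x
    using subgroup.m_inv_closed[OF S that] subgroup.mem_carrier[OF S that] by simp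
  have zero: "0 \<in> S" using subgroup.one_closed[OF S] by simp
  \<comment> \<open>\<open>S'\<close> is the full preimage of \<open>S\<close> under reduction
    modulo \<open>r\<close>, so it inherits the subgroup properties.\<close>
  have S': "x \<in> S' \<longleftrightarrow> 0 \<le> x \<and> x < 2 * int r \<and> x mod int r \<in> S" for x
  proof
    assume "x \<in> S'"
    then obtain p y where "x = clift (int r) p y" "y \<in> S" by (auto simp: S'_def)
    moreover from this have "0 \<le> y" "y < int r" using Sr by auto
    ultimately show "0 \<le> x \<and> x < 2 * int r \<and> x mod int r \<in> S"
      using clift_bounds by (simp add: clift_mod)
  next
    assume x: "0 \<le> x \<and> x < 2 * int r \<and> x mod int r \<in> S"
    then have "x = clift (int r) (odd x) (x mod int r)" using clift_unique r by simp
    with x show "x \<in> S'" unfolding S'_def by (cases "odd x") auto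
  qed
  have C: "carrier (integer_mod_group (2 * r)) = {0..<2 * int r}"
    using r by (simp add: carrier_integer_mod_group)
  have neg: "(- x) mod (2 * int r) mod int r = (- (x mod int r)) mod int r" for x
    by (simp add: mod_mod_cancel mod_minus_eq)
  have add: "(x + y) mod (2 * int r) mod int r = (x mod int r + y mod int r) mod int r" for x y
    by (simp add: mod_mod_cancel mod_add_eq)
  have "S' \<subseteq> carrier (integer_mod_group (2 * r))"
    unfolding C by (simp add: subset_iff S')
  moreover have "0 \<in> S'" using zero r by (simp add: S')
  moreover have "inv\<^bsub>integer_mod_group (2 * r)\<^esub> x \<in> S'" if "x \<in> S'" for x
  proof -
    have "inv\<^bsub>integer_mod_group (2 * r)\<^esub> x = (- x) mod (2 * int r)"
      using that inv_integer_mod_group[of x "2 * r"] by (simp add: C S')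
    then show ?thesis using that r inv_closed[of "x mod int r"] by (simp add: S' neg)
  qed
  moreover have "x \<otimes>\<^bsub>integer_mod_group (2 * r)\<^esub> y \<in> S'" if "x \<in> S'" "y \<in> S'" for x y
    using that r closed[of "x mod int r" "y mod int r"] by (simp add: S' add)
  ultimately show "subgroup S' (integer_mod_group (2 * r))"
    by (intro group.subgroupI) auto
  have inj: "inj_on (clift (int r) p) S" for p
    using Sr by (intro inj_on_inverseI[of _ "\<lambda>x. x mod int r"]) (auto simp: clift_mod)
  have "clift (int r) True x \<noteq> clift (int r) False y" for x y
    using even_clift[OF r(1), of True x] even_clift[OF r(1), of False y] by metis
  then have "clift (int r) True ` S \<inter> clift (int r) False ` S = {}"
    by blast
  then show "card S' = 2 * card S"
    unfolding S'_def by (simp add: card_Un_disjoint fin card_image[OF inj])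
  have "2 * x \<in> clift (int r) False ` S" if "x \<in> S" for x
  proof
    show "2 * x = clift (int r) False (2 * x mod int r)"
      using clift_unique[of "int r" "2 * x"] r Sr that by auto
    show "2 * x mod int r \<in> S" using closed[OF that that] by (simp only: mult_2)
  qed
  then have "(\<lambda>x. 2 * x) ` S \<subseteq> clift (int r) False ` S" by blast
  \<comment> \<open>Doubling representatives and taking even lifts are both injective on
    \<open>S\<close>, so the inclusion is an equality by counting.\<close>
  moreover have "card ((\<lambda>x. 2 * x) ` S) = card (clift (int r) False ` S)"
    using card_image[OF inj] by (simp add: card_image inj_on_def)
  ultimately show "clift (int r) False ` S = (\<lambda>x. 2 * x) ` S"
    using fin by (intro card_subset_eq[symmetric]) simp_all
qed

context odd_moduli
begin

lemma regular_doubled: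
  assumes reg: "regular M N s t F"
    and leave: "leave (2 * M) (2 * N) G =
      lam ` ({1, 2, 3} \<times> (leave M N F \<union> {(0, 0)}) \<union> {0} \<times> leave M N F)"
  shows "regular (2 * M) (2 * N) (2 * s) (2 * t) G"
proof -
  obtain S T where S: "subgroup S (integer_mod_group M)" "card S = s"
    and T: "subgroup T (integer_mod_group N)" "card T = t"
    and L: "leave M N F \<union> {(0, 0)} = S \<times> T"
    using reg unfolding regular_def by blast
  define So Se To Te where "So = clift (int M) True ` S" and "Se = clift (int M) False ` S"
    and "To = clift (int N) True ` T" and "Te = clift (int N) False ` T"
  \<comment> \<open>Adjoining (0, 0) fills the gap in class 0, so that every class lies over all of
    \<open>S \<times> T\<close>.\<close>
  have "leave (2 * M) (2 * N) G \<union> {(0, 0)} =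
      lam ` ({1} \<times> (S \<times> T)) \<union> lam ` ({2} \<times> (S \<times> T)) \<union> lam ` ({3} \<times> (S \<times> T)) \<union> lam ` ({0} \<times> (S \<times> T))"
    unfolding leave L[symmetric] by (auto simp: lam_0 dbl_def image_Un)
  also have "lam ` ({1} \<times> (S \<times> T)) = So \<times> Te"
    unfolding lam_def So_def Te_def by force
  also have "lam ` ({2} \<times> (S \<times> T)) = Se \<times> To"
    unfolding lam_def Se_def To_def by force
  also have "lam ` ({3} \<times> (S \<times> T)) = So \<times> To"
    unfolding lam_def So_def To_def by force
  \<comment> \<open>Class 0 consists of doubles, which by the third part of
    \<open>subgroup_clift\<close> are exactly the even lifts.\<close>
  also have "lam ` ({0} \<times> (S \<times> T)) = Se \<times> Te"
    unfolding lam_def Se_def Te_def subgroup_clift(3)[OF odd_M S(1)] subgroup_clift(3)[OF odd_N T(1)]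
    by force
  also have "So \<times> Te \<union> Se \<times> To \<union> So \<times> To \<union> Se \<times> Te = (So \<union> Se) \<times> (To \<union> Te)"
    by blast
  finally show ?thesis
    using subgroup_clift(1,2)[OF odd_M S(1)] subgroup_clift(1,2)[OF odd_N T(1)] S(2) T(2)
    unfolding regular_def So_def Se_def To_def Te_def by metis
qed

end

theorem mainTheorem3:
  fixes m n :: nat and F :: "(int \<times> int) set set" and L :: "(int \<times> int) set"
  assumes "m mod 4 = 2" and "n mod 4 = 2"
    and "oospc (m div 2) (n div 2) 3 1 1 F"
    and "leave (m div 2) (n div 2) F = L"
  shows "\<exists>G. oospc m n 3 2 1 G \<and> card G = 5 * card F \<and>
           leave m n G = (\<Union>p \<in> L \<union> {(0, 0)}. D m n p - A_ee m n) \<union> (\<Union>p \<in> L. {dbl p}) \<and>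
           (\<forall>s t. regular (m div 2) (n div 2) s t F \<longrightarrow> regular m n (2 * s) (2 * t) G)"
proof -
  \<comment> \<open>Residue 2 modulo 4 makes both halves odd, as the parity lifts require.\<close>
  have "odd (m div 2)" "odd (n div 2)" and mn: "2 * (m div 2) = m" "2 * (n div 2) = n"
    using assms(1,2) by presburger+
  then interpret odd_moduli "m div 2" "n div 2" by unfold_locales
  from assms(3) obtain G where G: "oospc m n 3 2 1 G" "card G = 5 * card F"
    "(\<Union>W\<in>G. supp_diff m n W) = lam ` ({..3} \<times> (\<Union>X\<in>F. supp_diff (m div 2) (n div 2) X))"
    by (rule doubled_oospc[unfolded mn])
  note lv = leave_eq[unfolded mn, OF G(3) assms(3)]
  have "leave m n G = (\<Union>p \<in> L \<union> {(0, 0)}. D m n p - A_ee m n) \<union> (\<Union>p \<in> L. {dbl p})"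
    using lv lam_leave_eq[OF leave_subset[of F], unfolded mn] by (simp only: assms(4))
  moreover have "regular m n (2 * s) (2 * t) G" if "regular (m div 2) (n div 2) s t F" for s t
    using regular_doubled[unfolded mn, OF that lv] .
  ultimately show ?thesis using G by blast
qed

end
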